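(* Let $s \geq 1$ and $t \geq 2$ be integers and let $\varepsilon > 0$ be a real number. Then $f_{s+1}(t,n) > n^{s-\varepsilon}$ for all sufficiently large integers $n$.
   Context: For an integer $r\ge 2$, an $r$-uniform hypergraph is a pair $H=(V,E)$ where $V$ is a nonempty finite set of vertices and $E\subseteq\binom{V}{r}$ (the set of $r$-element subsets of $V$). A set $X\subseteq V$ is a clique of $H$ if $\binom{X}{r}\subseteq E$ (so every set with fewer than $r$ vertices is a clique). A clique is maximal if it is maximal with respect to inclusion, and $c(H)$ is the number of maximal cliques of $H$. $K^r_n=(V,\binom{V}{r})$ with $|V|=n$ is the complete $r$-uniform hypergraph of order $n$. For integers $r,t\geq2$ and $n\geq1$, $f_r(t,n)$ is the minimum of $\sum_{i=1}^t c(H_i)$ over all factorizations of $K^r_n$ into $t$ edge-disjoint spanning subgraphs $H_1,\dots,H_t$, i.e. over all ways of writing $\binom{V}{r}$ as a disjoint union $E_1\cup\dots\cup E_t$ (parts may be empty) with $H_i=(V,E_i)$. *)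

theory Defs
  imports Complex_Main "HOL-Library.Disjoint_Sets" "HOL-Library.Ramsey"
begin

text \<open>A hypergraph is given by its uniformity \<open>r\<close>, its vertex set \<open>V\<close> and its edge set \<open>E\<close>;
  \<open>[X]\<^bsup>r\<^esup>\<close> is the library notation for the set of \<open>r\<close>-element subsets of \<open>X\<close>.\<close>

definition uniform_hypergraph :: "nat \<Rightarrow> 'a set \<Rightarrow> 'a set set \<Rightarrow> bool" where
  "uniform_hypergraph r V E \<longleftrightarrow> finite V \<and> V \<noteq> {} \<and> E \<subseteq> [V]\<^bsup>r\<^esup>"

definition hyperclique :: "nat \<Rightarrow> 'a set \<Rightarrow> 'a set set \<Rightarrow> 'a set \<Rightarrow> bool" where
  "hyperclique r V E X \<longleftrightarrow> X \<subseteq> V \<and> [X]\<^bsup>r\<^esup> \<subseteq> E"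

definition maximal_clique :: "nat \<Rightarrow> 'a set \<Rightarrow> 'a set set \<Rightarrow> 'a set \<Rightarrow> bool" where
  "maximal_clique r V E X \<longleftrightarrow>
     hyperclique r V E X \<and> (\<forall>Y. hyperclique r V E Y \<and> X \<subseteq> Y \<longrightarrow> Y = X)"

definition num_maximal_cliques :: "nat \<Rightarrow> 'a set \<Rightarrow> 'a set set \<Rightarrow> nat" where
  "num_maximal_cliques r V E = card {X. maximal_clique r V E X}"

definition factorization :: "nat \<Rightarrow> nat \<Rightarrow> 'a set \<Rightarrow> (nat \<Rightarrow> 'a set set) \<Rightarrow> bool" where
  "factorization r t V E \<longleftrightarrow>
     (\<forall>i\<in>{1..t}. uniform_hypergraph r V (E i)) \<and>
     disjoint_family_on E {1..t} \<and> (\<Union>i\<in>{1..t}. E i) = [V]\<^bsup>r\<^esup>"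

text \<open>The complete hypergraph of order \<open>n\<close> is realised on the vertex set \<open>{..<n}\<close>; the number of
  maximal cliques depends only on the isomorphism type, so this choice is immaterial. The minimum
  is a genuine one for \<open>n \<ge> 1\<close> and \<open>t \<ge> 1\<close>, by \<open>factorization_exists\<close> and \<open>min_clique_sum_attained\<close>.\<close>

definition min_clique_sum :: "nat \<Rightarrow> nat \<Rightarrow> nat \<Rightarrow> nat" where
  "min_clique_sum r t n =
     (LEAST m. \<exists>E. factorization r t {..<n} E \<and>
        m = (\<Sum>i=1..t. num_maximal_cliques r {..<n} (E i)))"

lemma factorization_exists:
  assumes "finite V" "V \<noteq> {}" "t \<ge> 1"
  shows "\<exists>E. factorization r t V E"
proof -
  have "factorization r t V (\<lambda>i. if i = 1 then [V]\<^bsup>r\<^esup> else {})"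
    using assms unfolding factorization_def uniform_hypergraph_def disjoint_family_on_def
    by auto
  then show ?thesis by blast
qed

lemma min_clique_sum_attained:
  assumes "n \<ge> 1" "t \<ge> 1"
  shows "\<exists>E. factorization r t {..<n} E \<and>
           min_clique_sum r t n = (\<Sum>i=1..t. num_maximal_cliques r {..<n} (E i))"
proof -
  have "{..<n} \<noteq> {}"
    using assms(1) by (auto simp: lessThan_empty_iff)
  then obtain E where "factorization r t {..<n} E"
    using factorization_exists[of "{..<n}" t r] assms(2) by auto
  then have "\<exists>m E. factorization r t {..<n} E \<and>
      m = (\<Sum>i=1..t. num_maximal_cliques r {..<n} (E i))"
    by blast
  then show ?thesis
    unfolding min_clique_sum_def by (rule LeastI_ex)
qed

lemma min_clique_sum_le:
  assumes "factorization r t {..<n} E"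
  shows "min_clique_sum r t n \<le> (\<Sum>i=1..t. num_maximal_cliques r {..<n} (E i))"
  unfolding min_clique_sum_def using assms by (blast intro: Least_le)

end

theory Submission
  imports Defs "HOL-Library.FuncSet"
begin

text \<open>
  Put \<open>r = s + 1\<close> and let \<open>M\<close> be the total number of maximal cliques. Suppose that
  \<open>M \<le> n powr (s - \<epsilon>)\<close>. The proof follows the number of maximal cliques of
  colour \<open>i\<close> that contain a given set \<open>A\<close>, and shows that it usually drops by the factor
  \<open>K = n powr (\<epsilon> / 2)\<close> whenever an \<open>s\<close>-set is added to \<open>A\<close>.

  Call an \<open>s\<close>-set \<open>T\<close> heavy for \<open>(i, A)\<close> if it violates this, that is, if more than a \<open>1 / K\<close>
  fraction of the maximal \<open>i\<close>-cliques above \<open>A\<close> contain \<open>T\<close>. Two different \<open>s\<close>-sets inside a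
  clique of another colour \<open>j\<close> span an edge of colour \<open>j\<close>, so they lie in no common \<open>i\<close>-clique.
  Hence a \<open>j\<close>-clique contains at most \<open>K\<close> heavy sets (\<open>heavy_in_other_colour_clique\<close>). But every
  \<open>s\<close>-set is a clique of colour \<open>j\<close> for want of edges, and so lies in one of the at most \<open>M\<close>
  maximal ones. There are thus at most \<open>K * M\<close> heavy sets, a vanishing proportion of all
  \<open>s\<close>-sets (\<open>card_heavy_le\<close>).

  As heavy sets are rare, for every constant \<open>R\<close> and all large \<open>n\<close> a counting argument yields \<open>R\<close>
  distinct vertices such that no \<open>s\<close> of them are heavy for any \<open>(i, A)\<close> with \<open>A\<close> among the others
  (\<open>avoiding_placement\<close>). If \<open>R\<close> is a suitable Ramsey number, these vertices contain a clique \<open>W\<close>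
  of some colour \<open>i\<close> with \<open>s * L\<close> vertices, where \<open>L > 2 * s / \<epsilon>\<close>. Splitting \<open>W\<close> into \<open>L\<close> blocks
  of size \<open>s\<close> and adding them one at a time shows that at most \<open>M / K ^ L\<close> maximal
  \<open>i\<close>-cliques contain \<open>W\<close> (\<open>geometric_decay\<close>). There is at least one, so \<open>M \<ge> K ^ L > n ^ s\<close>, a contradiction.
\<close>

section \<open>Heavy sets\<close>

definition maximal_cliques_above :: "nat \<Rightarrow> 'a set \<Rightarrow> 'a set set \<Rightarrow> 'a set \<Rightarrow> 'a set set" where
  "maximal_cliques_above r V E A = {X. maximal_clique r V E X \<and> A \<subseteq> X}"

abbreviation cliques_above :: "nat \<Rightarrow> 'a set \<Rightarrow> 'a set set \<Rightarrow> 'a set \<Rightarrow> real" where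
  "cliques_above r V E A \<equiv> real (card (maximal_cliques_above r V E A))"

definition heavy :: "nat \<Rightarrow> 'a set \<Rightarrow> 'a set set \<Rightarrow> real \<Rightarrow> 'a set \<Rightarrow> 'a set set" where
  "heavy s V E K A =
     {T \<in> [V]\<^bsup>s\<^esup>. cliques_above (Suc s) V E A < K * cliques_above (Suc s) V E (A \<union> T)}"

lemma finite_maximal_cliques:
  assumes "finite V"
  shows "finite {X. maximal_clique r V E X}"
  by (rule finite_subset[of _ "Pow V"])
    (use assms in \<open>auto simp: maximal_clique_def hyperclique_def\<close>)

lemma finite_maximal_cliques_above: "finite V \<Longrightarrow> finite (maximal_cliques_above r V E A)"
  unfolding maximal_cliques_above_def
  by (rule finite_subset[OF _ finite_maximal_cliques[of V r E]]) auto

lemma hyperclique_extends_to_maximal: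
  assumes "finite V" "hyperclique r V E X"
  obtains Y where "maximal_clique r V E Y" "X \<subseteq> Y"
proof -
  let ?C = "{Y. hyperclique r V E Y}"
  have "finite ?C"
    by (rule finite_subset[of _ "Pow V"]) (use assms(1) in \<open>auto simp: hyperclique_def\<close>)
  moreover have "X \<in> ?C" using assms(2) by simp
  ultimately obtain Y where "Y \<in> ?C" "X \<subseteq> Y" "\<forall>Z\<in>?C. Y \<subseteq> Z \<longrightarrow> Y = Z"
    using finite_has_maximal2[of ?C X] by blast
  then show ?thesis
    using that unfolding maximal_clique_def by blast
qed

lemma factorization_disjoint:
  assumes "factorization r t V E" "i \<in> {1..t}" "j \<in> {1..t}" "i \<noteq> j"
  shows "E i \<inter> E j = {}"
  using assms unfolding factorization_def disjoint_family_on_def by blast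

text \<open>Distinct \<open>s\<close>-sets \<open>T\<close> and \<open>T'\<close> inside a clique of colour \<open>F\<close> have at least \<open>s + 1\<close> vertices
  together, so \<open>T \<union> T'\<close> contains an edge of \<open>F\<close> and is not a clique of \<open>E\<close>. The families of maximal
  \<open>E\<close>-cliques above \<open>A \<union> T\<close>, each of them more than a \<open>1 / K\<close> fraction of those above \<open>A\<close>, are
  therefore pairwise disjoint.\<close>

lemma heavy_in_other_colour_clique:
  assumes V: "finite V" and EF: "E \<inter> F = {}" and X: "hyperclique (Suc s) V F X" and K: "K \<ge> 0"
  shows "real (card {T \<in> heavy s V E K A. T \<subseteq> X}) \<le> K"
proof -
  let ?above = "\<lambda>B. maximal_cliques_above (Suc s) V E B"
  let ?N = "real (card (?above A))"
  define S where "S = {T \<in> heavy s V E K A. T \<subseteq> X}"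
  have finS: "finite S"
    by (rule finite_subset[of _ "Pow V"]) (use V in \<open>auto simp: S_def heavy_def nsets_def\<close>)
  have disj: "?above (A \<union> T) \<inter> ?above (A \<union> T') = {}"
    if "T \<in> S" "T' \<in> S" "T \<noteq> T'" for T T'
  proof (rule ccontr)
    assume "?above (A \<union> T) \<inter> ?above (A \<union> T') \<noteq> {}"
    then obtain Y where "maximal_clique (Suc s) V E Y" "T \<union> T' \<subseteq> Y"
      by (auto simp: maximal_cliques_above_def)
    then have Y: "hyperclique (Suc s) V E Y" "T \<union> T' \<subseteq> Y"
      by (simp_all add: maximal_clique_def)
    have T: "finite T" "card T = s" "finite T'" "card T' = s" "T \<union> T' \<subseteq> X"
      using that by (auto simp: S_def heavy_def nsets_def)
    have "\<not> T' \<subseteq> T"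
      using T that(3) card_subset_eq[of T T'] by auto
    then obtain x where x: "x \<in> T'" "x \<notin> T" by blast
    then have "insert x T \<in> [T \<union> T']\<^bsup>Suc s\<^esup>"
      using T by (auto simp: nsets_def)
    then have "insert x T \<in> [Y]\<^bsup>Suc s\<^esup>" "insert x T \<in> [X]\<^bsup>Suc s\<^esup>"
      using nsets_mono[OF Y(2)] nsets_mono[OF T(5)] by blast+
    then have "insert x T \<in> E \<inter> F"
      using Y(1) X unfolding hyperclique_def by blast
    then show False using EF by simp
  qed
  have "(\<Sum>T\<in>S. card (?above (A \<union> T))) = card (\<Union>T\<in>S. ?above (A \<union> T))"
    by (rule card_UN_disjoint[symmetric])
      (use finS disj V in \<open>auto simp: finite_maximal_cliques_above\<close>)
  also have "\<dots> \<le> card (?above A)"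
    by (intro card_mono finite_maximal_cliques_above V) (auto simp: maximal_cliques_above_def)
  finally have sum_le: "(\<Sum>T\<in>S. real (card (?above (A \<union> T)))) \<le> ?N"
    by (simp only: flip: of_nat_sum of_nat_le_iff)
  have "real (card S) \<le> K"
  proof (cases "S = {}")
    case True
    then show ?thesis using K by simp
  next
    case False
    then obtain T where T: "T \<in> S" by blast
    have "?N > 0"
    proof (rule ccontr)
      assume "\<not> ?N > 0"
      then have "?above A = {}"
        using V by (simp add: finite_maximal_cliques_above)
      then have "?above (A \<union> T) = {}"
        by (auto simp: maximal_cliques_above_def)
      with T show False by (simp add: S_def heavy_def)
    qed
    have "real (card S) * ?N = (\<Sum>T\<in>S. ?N)" by simp
    also have "\<dots> \<le> (\<Sum>T\<in>S. K * real (card (?above (A \<union> T))))"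
      by (rule sum_mono) (auto simp: S_def heavy_def)
    also have "\<dots> \<le> K * ?N"
      using mult_left_mono[OF sum_le K] by (simp add: sum_distrib_left)
    finally show ?thesis using \<open>?N > 0\<close> by simp
  qed
  then show ?thesis unfolding S_def .
qed

text \<open>An \<open>s\<close>-set contains no \<open>s + 1\<close> vertices and so is a clique of every colour. Hence the maximal
  cliques of \<open>F\<close> cover all heavy sets of \<open>E\<close>, with at most \<open>K\<close> of them in each.\<close>

lemma card_heavy_le:
  assumes V: "finite V" and EF: "E \<inter> F = {}" and K: "K \<ge> 0"
  shows "real (card (heavy s V E K A)) \<le> K * real (num_maximal_cliques (Suc s) V F)"
proof -
  let ?MC = "{X. maximal_clique (Suc s) V F X}"
  let ?S = "\<lambda>X. {T \<in> heavy s V E K A. T \<subseteq> X}"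
  have finMC: "finite ?MC" using V by (rule finite_maximal_cliques)
  have finH: "finite (heavy s V E K A)"
    by (rule finite_subset[of _ "Pow V"]) (use V in \<open>auto simp: heavy_def nsets_def\<close>)
  have cover: "heavy s V E K A \<subseteq> (\<Union>X\<in>?MC. ?S X)"
  proof
    fix T assume T: "T \<in> heavy s V E K A"
    then have "hyperclique (Suc s) V F T"
      by (auto simp: heavy_def nsets_def hyperclique_def dest: card_mono)
    then obtain X where "maximal_clique (Suc s) V F X" "T \<subseteq> X"
      using hyperclique_extends_to_maximal[OF V] by blast
    with T show "T \<in> (\<Union>X\<in>?MC. ?S X)" by blast
  qed
  have "card (heavy s V E K A) \<le> card (\<Union>X\<in>?MC. ?S X)"
    by (rule card_mono[OF _ cover]) (use finMC finH in auto)
  also have "\<dots> \<le> (\<Sum>X\<in>?MC. card (?S X))"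
    by (rule card_UN_le[OF finMC])
  finally have "real (card (heavy s V E K A)) \<le> (\<Sum>X\<in>?MC. real (card (?S X)))"
    by (simp only: flip: of_nat_sum of_nat_le_iff)
  also have "\<dots> \<le> (\<Sum>X\<in>?MC. K)"
  proof (rule sum_mono)
    fix X assume "X \<in> ?MC"
    then show "real (card (?S X)) \<le> K"
      using heavy_in_other_colour_clique[OF V EF _ K] by (auto simp: maximal_clique_def)
  qed
  finally show ?thesis by (simp add: num_maximal_cliques_def mult.commute)
qed

section \<open>Placing vertices so as to avoid rare sets\<close>

text \<open>If, whatever the values outside \<open>J\<close>, at most \<open>B\<close> choices on \<open>J\<close> satisfy a condition, then the
  condition has probability at most \<open>B / card V ^ card J\<close> for a uniformly random function.\<close>

lemma card_functions_restricted_le: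
  fixes B :: real
  assumes D: "finite D" and V: "finite V" "V \<noteq> {}" and J: "J \<subseteq> D"
    and B: "\<And>h. real (card {g \<in> J \<rightarrow>\<^sub>E V. P h g}) \<le> B"
  shows "real (card {f \<in> D \<rightarrow>\<^sub>E V. P (restrict f (D - J)) (restrict f J)})
           \<le> real (card V) ^ card D * (B / real (card V) ^ card J)"
proof -
  let ?n = "real (card V)"
  let ?S = "{f \<in> D \<rightarrow>\<^sub>E V. P (restrict f (D - J)) (restrict f J)}"
  let ?Q = "SIGMA h : (D - J) \<rightarrow>\<^sub>E V. {g \<in> J \<rightarrow>\<^sub>E V. P h g}"
  let ?split = "\<lambda>f. (restrict f (D - J), restrict f J)"
  have finJ: "finite J" using D J finite_subset by blast
  have finE: "finite ((D - J) \<rightarrow>\<^sub>E V)" "finite (J \<rightarrow>\<^sub>E V)"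
    using D V finJ by (auto intro: finite_PiE)
  have "inj_on ?split (D \<rightarrow>\<^sub>E V)"
  proof (rule inj_onI)
    fix f g assume fg: "f \<in> D \<rightarrow>\<^sub>E V" "g \<in> D \<rightarrow>\<^sub>E V" "?split f = ?split g"
    show "f = g"
    proof (rule PiE_ext[OF fg(1,2)])
      fix x assume "x \<in> D"
      then show "f x = g x"
        using fg(3) by (cases "x \<in> J") (auto dest!: fun_cong[where x = x] simp: restrict_def)
    qed
  qed
  then have "inj_on ?split ?S" by (rule inj_on_subset) auto
  moreover have "?split ` ?S \<subseteq> ?Q" using J by auto
  moreover have "finite ?Q" using finE by auto
  ultimately have "card ?S \<le> card ?Q" by (rule card_inj_on_le)
  also have "card ?Q = (\<Sum>h\<in>(D - J) \<rightarrow>\<^sub>E V. card {g \<in> J \<rightarrow>\<^sub>E V. P h g})"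
    using finE by (intro card_SigmaI) auto
  finally have "real (card ?S) \<le> (\<Sum>h\<in>(D - J) \<rightarrow>\<^sub>E V. real (card {g \<in> J \<rightarrow>\<^sub>E V. P h g}))"
    by (simp only: flip: of_nat_sum of_nat_le_iff)
  also have "\<dots> \<le> (\<Sum>h\<in>(D - J) \<rightarrow>\<^sub>E V. B)" by (rule sum_mono) (rule B)
  also have "\<dots> = ?n ^ (card D - card J) * B"
    using D J by (simp add: card_funcsetE card_Diff_subset finJ)
  also have "\<dots> = ?n ^ card D * (B / ?n ^ card J)"
    using V card_mono[OF D J] by (simp add: power_diff field_simps)
  finally show ?thesis .
qed

lemma card_functions_onto_le:
  assumes V: "finite V" and J: "finite J" "card J = s" and \<B>: "finite \<B>"
  shows "card {g \<in> J \<rightarrow>\<^sub>E V. g ` J \<in> \<B>} \<le> s ^ s * card \<B>"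
proof -
  let ?\<B> = "{T \<in> \<B>. finite T \<and> card T \<le> s}"
  have "{g \<in> J \<rightarrow>\<^sub>E V. g ` J \<in> \<B>} \<subseteq> (\<Union>T\<in>?\<B>. J \<rightarrow>\<^sub>E T)"
  proof
    fix g assume g: "g \<in> {g \<in> J \<rightarrow>\<^sub>E V. g ` J \<in> \<B>}"
    then have "g ` J \<in> ?\<B>" using J card_image_le by auto
    moreover have "g \<in> J \<rightarrow>\<^sub>E g ` J" using g by (auto simp: PiE_iff)
    ultimately show "g \<in> (\<Union>T\<in>?\<B>. J \<rightarrow>\<^sub>E T)" by blast
  qed
  then have "card {g \<in> J \<rightarrow>\<^sub>E V. g ` J \<in> \<B>} \<le> card (\<Union>T\<in>?\<B>. J \<rightarrow>\<^sub>E T)"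
    by (rule card_mono[rotated]) (use \<B> J in \<open>auto intro!: finite_PiE\<close>)
  also have "\<dots> \<le> (\<Sum>T\<in>?\<B>. card (J \<rightarrow>\<^sub>E T))"
    by (rule card_UN_le) (use \<B> in auto)
  also have "\<dots> \<le> (\<Sum>T\<in>?\<B>. s ^ s)"
    by (rule sum_mono) (use J in \<open>auto simp: card_funcsetE power_mono\<close>)
  also have "\<dots> \<le> s ^ s * card \<B>"
    using card_mono[of \<B> ?\<B>] \<B> by simp
  finally show ?thesis .
qed

text \<open>A union bound over all ways in which a random function \<open>{..<R} \<rightarrow> V\<close> can fail. The sets to be
  avoided by the image of \<open>J\<close> may depend on the image of \<open>I\<close>; as \<open>I\<close> and \<open>J\<close> are disjoint, one
  may fix the values outside \<open>J\<close> and count the choices on \<open>J\<close>.\<close>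

lemma avoiding_placement:
  fixes V :: "'a set" and bad :: "'c \<Rightarrow> 'a set \<Rightarrow> 'a set set" and b :: real
  assumes V: "finite V" "V \<noteq> {}" and C: "finite C"
    and bad: "\<And>c A. c \<in> C \<Longrightarrow> finite (bad c A) \<and> real (card (bad c A)) \<le> b"
    and small: "real (card C) * 4 ^ R * (real s ^ s * b / real (card V) ^ s)
                  + real R ^ 2 / real (card V) < 1"
    and b: "b \<ge> 0"
  obtains f where "f \<in> {..<R} \<rightarrow> V" "inj_on f {..<R}"
    "\<And>c I J. \<lbrakk>c \<in> C; I \<subseteq> {..<R}; J \<subseteq> {..<R}; I \<inter> J = {}; card J = s\<rbrakk> \<Longrightarrow> f ` J \<notin> bad c (f ` I)"
proof -
  let ?n = "real (card V)"
  let ?F = "{..<R} \<rightarrow>\<^sub>E V"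
  define Idx where "Idx = {(c, I, J). c \<in> C \<and> I \<subseteq> {..<R} \<and> J \<subseteq> {..<R} \<and> I \<inter> J = {} \<and> card J = s}"
  define hit where "hit = (\<lambda>(c, I, J). {f \<in> ?F. f ` J \<in> bad c (f ` I)})"
  define Prs where "Prs = {(p, q). p < R \<and> q < R \<and> p \<noteq> q}"
  define coincide where "coincide = (\<lambda>(p, q). {f \<in> ?F. f p = f q})"
  have npos: "?n > 0" using V by (simp add: card_gt_0_iff)
  have finF: "finite ?F" using V by (auto intro: finite_PiE)
  have Idx_sub: "Idx \<subseteq> C \<times> Pow {..<R} \<times> Pow {..<R}" by (auto simp: Idx_def)
  have finIdx: "finite Idx" by (rule finite_subset[OF Idx_sub]) (use C in auto)
  have "card Idx \<le> card (C \<times> Pow {..<R} \<times> Pow {..<R})"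
    by (rule card_mono[OF _ Idx_sub]) (use C in auto)
  also have "\<dots> = card C * 4 ^ R"
    by (simp add: card_cartesian_product card_Pow power_mult_distrib[symmetric])
  finally have card_Idx: "real (card Idx) \<le> real (card C) * 4 ^ R"
    by (metis of_nat_le_iff of_nat_mult of_nat_numeral of_nat_power)
  have Prs_sub: "Prs \<subseteq> {..<R} \<times> {..<R}" by (auto simp: Prs_def)
  have finPrs: "finite Prs" by (rule finite_subset[OF Prs_sub]) auto
  have "card Prs \<le> card ({..<R} \<times> {..<R})" by (rule card_mono[OF _ Prs_sub]) auto
  then have card_Prs: "real (card Prs) \<le> real R ^ 2"
    by (simp add: card_cartesian_product power2_eq_square flip: of_nat_mult)
  have hit_le: "real (card (hit x)) \<le> ?n ^ R * (real s ^ s * b / ?n ^ s)" if x: "x \<in> Idx" for x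
  proof -
    obtain c I J where xe: "x = (c, I, J)" by (cases x)
    have cIJ: "c \<in> C" "I \<subseteq> {..<R}" "J \<subseteq> {..<R}" "I \<inter> J = {}" "card J = s"
      using x by (auto simp: Idx_def xe)
    have finJ: "finite J" using cIJ(3) finite_subset by blast
    have choices: "real (card {g \<in> J \<rightarrow>\<^sub>E V. g ` J \<in> bad c (h ` I)}) \<le> real s ^ s * b" for h
    proof -
      have "real (card {g \<in> J \<rightarrow>\<^sub>E V. g ` J \<in> bad c (h ` I)}) \<le> real (s ^ s * card (bad c (h ` I)))"
        using card_functions_onto_le[OF V(1) finJ cIJ(5)] bad[OF cIJ(1)] of_nat_le_iff by blast
      also have "\<dots> \<le> real s ^ s * b"
        using bad[OF cIJ(1), of "h ` I"] by (simp add: mult_left_mono)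
      finally show ?thesis .
    qed
    have "hit x = {f \<in> ?F. restrict f J ` J \<in> bad c (restrict f ({..<R} - J) ` I)}"
    proof -
      have "restrict f ({..<R} - J) ` I = f ` I" for f :: "nat \<Rightarrow> 'a"
        by (rule image_cong) (use cIJ in auto)
      then show ?thesis by (simp add: hit_def xe)
    qed
    then show ?thesis
      using card_functions_restricted_le[OF _ V cIJ(3),
          of "\<lambda>h g. g ` J \<in> bad c (h ` I)" "real s ^ s * b"] choices cIJ(5) by simp
  qed
  have coincide_le: "real (card (coincide x)) \<le> ?n ^ R * (1 / ?n)" if x: "x \<in> Prs" for x
  proof -
    obtain p q where xe: "x = (p, q)" by (cases x)
    have pq: "p < R" "q < R" "p \<noteq> q" using x by (auto simp: Prs_def xe)
    have choices: "real (card {g \<in> {p} \<rightarrow>\<^sub>E V. g p = h q}) \<le> 1" for h :: "nat \<Rightarrow> 'a"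
    proof -
      have "{g \<in> {p} \<rightarrow>\<^sub>E V. g p = h q} \<subseteq> {\<lambda>x\<in>{p}. h q}"
        by (auto simp: PiE_iff extensional_def restrict_def)
      from card_mono[OF _ this] show ?thesis by simp
    qed
    have "coincide x = {f \<in> ?F. restrict f {p} p = restrict f ({..<R} - {p}) q}"
      using pq by (auto simp: coincide_def xe)
    then show ?thesis
      using card_functions_restricted_le[of "{..<R}" V "{p}" "\<lambda>h g. g p = h q" 1] V pq choices
      by simp
  qed
  let ?U = "(\<Union>x\<in>Idx. hit x) \<union> (\<Union>x\<in>Prs. coincide x)"
  have "real (card ?U) \<le> real (card (\<Union>x\<in>Idx. hit x)) + real (card (\<Union>x\<in>Prs. coincide x))"
    by (metis card_Un_le of_nat_add of_nat_le_iff)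
  also have "\<dots> \<le> (\<Sum>x\<in>Idx. real (card (hit x))) + (\<Sum>x\<in>Prs. real (card (coincide x)))"
    using card_UN_le[OF finIdx, of hit] card_UN_le[OF finPrs, of coincide]
    by (intro add_mono) (metis of_nat_le_iff of_nat_sum)+
  also have "\<dots> \<le> (\<Sum>x\<in>Idx. ?n ^ R * (real s ^ s * b / ?n ^ s)) + (\<Sum>x\<in>Prs. ?n ^ R * (1 / ?n))"
    by (intro add_mono sum_mono hit_le coincide_le)
  also have "\<dots> = ?n ^ R * (real (card Idx) * (real s ^ s * b / ?n ^ s) + real (card Prs) / ?n)"
    by (simp add: algebra_simps)
  also have "\<dots> \<le> ?n ^ R * (real (card C) * 4 ^ R * (real s ^ s * b / ?n ^ s) + real R ^ 2 / ?n)"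
    by (intro mult_left_mono add_mono mult_right_mono divide_right_mono card_Idx card_Prs)
      (use b npos in auto)
  also have "\<dots> < ?n ^ R * 1"
    by (rule mult_strict_left_mono[OF small]) (use npos in simp)
  also have "\<dots> = real (card ?F)" by (simp add: card_funcsetE)
  finally have "card ?U < card ?F" by simp
  then have "\<not> ?F \<subseteq> ?U"
    using card_mono[of ?U ?F] finF finIdx finPrs
    by (force simp: hit_def coincide_def)
  then obtain f where f: "f \<in> ?F" "f \<notin> ?U" by blast
  show ?thesis
  proof (rule that[of f])
    show "f \<in> {..<R} \<rightarrow> V" using f(1) by (simp add: PiE_def)
    show "inj_on f {..<R}"
      using f by (auto simp: inj_on_def coincide_def Prs_def)
    show "f ` J \<notin> bad c (f ` I)"
      if "c \<in> C" "I \<subseteq> {..<R}" "J \<subseteq> {..<R}" "I \<inter> J = {}" "card J = s" for c I J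
      using f that by (auto simp: hit_def Idx_def)
  qed
qed

section \<open>Monochromatic cliques and geometric decay\<close>

text \<open>Ramsey's theorem is applied to the indices \<open>{..<R}\<close> rather than to \<open>V\<close>, because only the
  chosen vertices \<open>f 0, \<dots>, f (R - 1)\<close> are known to avoid the heavy sets.\<close>

lemma ramsey_for_factorizations:
  "\<exists>R::nat. \<forall>(V :: 'a set) E f.
     factorization r t V E \<and> f \<in> {..<R} \<rightarrow> V \<and> inj_on f {..<R} \<longrightarrow>
     (\<exists>i\<in>{1..t}. \<exists>H. H \<subseteq> {..<R} \<and> card H = m \<and> hyperclique r V (E i) (f ` H))"
proof -
  obtain R where R: "partn_lst {..<R::nat} (replicate t m) r"
    using ramsey_full[of "replicate t m" r] by (rule exE)
  show ?thesis
  proof (intro exI[of _ R] allI impI, elim conjE)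
    fix V :: "'a set" and E f
    assume fac: "factorization r t V E" and f: "f \<in> {..<R} \<rightarrow> V" "inj_on f {..<R}"
    have "\<forall>e\<in>[{..<R}]\<^bsup>r\<^esup>. \<exists>k<t. f ` e \<in> E (Suc k)"
    proof
      fix e assume "e \<in> [{..<R}]\<^bsup>r\<^esup>"
      then have "f ` e \<in> [V]\<^bsup>r\<^esup>"
        using nsets_image_funcset[OF f] by blast
      then obtain i where i: "i \<in> {1..t}" "f ` e \<in> E i"
        using fac unfolding factorization_def by blast
      then show "\<exists>k<t. f ` e \<in> E (Suc k)"
        by (intro exI[of _ "i - 1"]) auto
    qed
    from bchoice[OF this]
    obtain \<chi> where \<chi>: "\<And>e. e \<in> [{..<R}]\<^bsup>r\<^esup> \<Longrightarrow> \<chi> e < t \<and> f ` e \<in> E (Suc (\<chi> e))"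
      by blast
    then have "\<chi> \<in> [{..<R}]\<^bsup>r\<^esup> \<rightarrow> {..<t}" by auto
    then obtain k H where k: "k < t" and H: "H \<in> [{..<R}]\<^bsup>m\<^esup>" "\<chi> ` [H]\<^bsup>r\<^esup> \<subseteq> {k}"
      using partn_lstE[OF R, of \<chi> t] by auto
    have HR: "H \<subseteq> {..<R}" "card H = m" using H(1) by (auto simp: nsets_def)
    have "[f ` H]\<^bsup>r\<^esup> \<subseteq> E (Suc k)"
    proof
      fix e assume "e \<in> [f ` H]\<^bsup>r\<^esup>"
      then obtain e' where e': "e' \<in> [H]\<^bsup>r\<^esup>" "e = f ` e'"
        by (rule nset_image_obtains[OF _ inj_on_subset[OF f(2) HR(1)]])
      moreover have "e' \<in> [{..<R}]\<^bsup>r\<^esup>" using e'(1) HR(1) nsets_mono by blast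
      ultimately show "e \<in> E (Suc k)" using \<chi>[of e'] H(2) by fastforce
    qed
    moreover have "f ` H \<subseteq> V" using f(1) HR(1) by blast
    ultimately have "hyperclique r V (E (Suc k)) (f ` H)"
      by (simp add: hyperclique_def)
    then show "\<exists>i\<in>{1..t}. \<exists>H. H \<subseteq> {..<R} \<and> card H = m \<and> hyperclique r V (E i) (f ` H)"
      using k HR by (intro bexI[of _ "Suc k"] exI[of _ H]) auto
  qed
qed

text \<open>Here \<open>g I\<close> will be the number of maximal cliques above the image of \<open>I\<close>. Removing one block
  of size \<open>s\<close> from \<open>H\<close> gains a factor \<open>K\<close>, and there are \<open>L\<close> blocks.\<close>

lemma geometric_decay:
  fixes g :: "'b set \<Rightarrow> real"
  assumes "finite H" "card H = s * L" "K \<ge> 0"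
    and "\<And>I J. \<lbrakk>I \<subseteq> H; J \<subseteq> H; I \<inter> J = {}; card J = s\<rbrakk> \<Longrightarrow> K * g (I \<union> J) \<le> g I"
  shows "K ^ L * g H \<le> g {}"
  using assms
proof (induction L arbitrary: H)
  case 0
  then show ?case by simp
next
  case (Suc L)
  obtain J where J: "J \<subseteq> H" "card J = s"
    using obtain_subset_with_card_n[of s H] Suc.prems(2) by auto
  let ?I = "H - J"
  have "card ?I = s * L"
    using Suc.prems J by (simp add: card_Diff_subset finite_subset)
  then have "K ^ L * g ?I \<le> g {}"
    using Suc.prems by (intro Suc.IH) blast+
  moreover have "K * g H \<le> g ?I"
    using Suc.prems(4)[of ?I J] J by (simp add: Un_absorb2 Diff_Int_distrib2)
  then have "K ^ L * (K * g H) \<le> K ^ L * g ?I"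
    using Suc.prems(3) by (intro mult_left_mono) auto
  ultimately show ?case by (simp add: mult.assoc mult.commute mult.left_commute)
qed

section \<open>The lower bound\<close>

text \<open>The argument for one factorization, with the threshold \<open>K\<close> and the number \<open>L\<close> of blocks left
  free. The bound \<open>small\<close> makes the placement possible, with \<open>K * M\<close> bounding the number of
  heavy sets.\<close>

lemma power_le_total_cliques:
  fixes V :: "'a set" and K M :: real
  assumes fac: "factorization (Suc s) t V E" and t: "t \<ge> 2" and V: "finite V" "V \<noteq> {}"
    and R: "\<And>f. \<lbrakk>f \<in> {..<R} \<rightarrow> V; inj_on f {..<R}\<rbrakk> \<Longrightarrow>
       \<exists>i\<in>{1..t}. \<exists>H. H \<subseteq> {..<R} \<and> card H = s * L \<and> hyperclique (Suc s) V (E i) (f ` H)"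
    and M: "\<And>i. i \<in> {1..t} \<Longrightarrow> real (num_maximal_cliques (Suc s) V (E i)) \<le> M"
    and K: "K \<ge> 0"
    and small: "real t * 4 ^ R * (real s ^ s * (K * M) / real (card V) ^ s)
                  + real R ^ 2 / real (card V) < 1"
  shows "K ^ L \<le> M"
proof -
  have M0: "M \<ge> 0" using M[of 1] t by (auto intro: order_trans[OF of_nat_0_le_iff])
  have rare: "finite (heavy s V (E i) K A) \<and> real (card (heavy s V (E i) K A)) \<le> K * M"
    if i: "i \<in> {1..t}" for i A
  proof
    show "finite (heavy s V (E i) K A)"
      by (rule finite_subset[of _ "Pow V"]) (use V in \<open>auto simp: heavy_def nsets_def\<close>)
    \<comment> \<open>Any second colour will do; this is where two colours are used.\<close>
    define j where "j = (if i = 1 then 2 else 1 :: nat)"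
    have j: "j \<in> {1..t}" "i \<noteq> j" using i t by (auto simp: j_def)
    have "real (card (heavy s V (E i) K A)) \<le> K * real (num_maximal_cliques (Suc s) V (E j))"
      using card_heavy_le[OF V(1) factorization_disjoint[OF fac i j] K] .
    also have "\<dots> \<le> K * M" using M[OF j(1)] K by (rule mult_left_mono)
    finally show "real (card (heavy s V (E i) K A)) \<le> K * M" .
  qed
  obtain f where f: "f \<in> {..<R} \<rightarrow> V" "inj_on f {..<R}"
    and light: "\<And>i I J. \<lbrakk>i \<in> {1..t}; I \<subseteq> {..<R}; J \<subseteq> {..<R}; I \<inter> J = {}; card J = s\<rbrakk> \<Longrightarrow>
      f ` J \<notin> heavy s V (E i) K (f ` I)"
    using avoiding_placement[of V "{1..t}" "\<lambda>i A. heavy s V (E i) K A" "K * M" R s]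
      V rare small K M0 by auto
  obtain i H where i: "i \<in> {1..t}" and H: "H \<subseteq> {..<R}" "card H = s * L"
    and clq: "hyperclique (Suc s) V (E i) (f ` H)"
    using R[OF f] by blast
  let ?g = "\<lambda>I. cliques_above (Suc s) V (E i) (f ` I)"
  have "K ^ L * ?g H \<le> ?g {}"
  proof (rule geometric_decay[where s = s])
    show "finite H" using H(1) finite_subset by blast
    fix I J assume IJ: "I \<subseteq> H" "J \<subseteq> H" "I \<inter> J = {}" "card J = s"
    have "f ` J \<in> [V]\<^bsup>s\<^esup>"
    proof -
      have "finite J" using IJ(2) H(1) by (meson finite_lessThan finite_subset)
      moreover have "inj_on f J" using f(2) IJ(2) H(1) by (meson inj_on_subset)
      ultimately show ?thesis
        using IJ H f(1) by (auto simp: nsets_def card_image)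
    qed
    moreover have "f ` J \<notin> heavy s V (E i) K (f ` I)"
      using light[OF i _ _ IJ(3,4)] IJ H by blast
    ultimately show "K * ?g (I \<union> J) \<le> ?g I"
      by (auto simp: heavy_def image_Un)
  qed (use H K in auto)
  moreover have "?g H \<ge> 1"
  proof -
    obtain X where "maximal_clique (Suc s) V (E i) X" "f ` H \<subseteq> X"
      by (rule hyperclique_extends_to_maximal[OF V(1) clq])
    then have "X \<in> maximal_cliques_above (Suc s) V (E i) (f ` H)"
      by (simp add: maximal_cliques_above_def)
    then show ?thesis
      using finite_maximal_cliques_above[OF V(1)] by (auto simp: Suc_le_eq card_gt_0_iff)
  qed
  then have "K ^ L * 1 \<le> K ^ L * ?g H"
    using K by (intro mult_left_mono) auto
  moreover have "?g {} = real (num_maximal_cliques (Suc s) V (E i))"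
    by (simp add: maximal_cliques_above_def num_maximal_cliques_def)
  ultimately show ?thesis using M[OF i] by linarith
qed

theorem theorem7:
  fixes s t :: nat and \<epsilon> :: real
  assumes "s \<ge> 1" and "t \<ge> 2" and "\<epsilon> > 0"
  shows "\<forall>\<^sub>F n in sequentially. real (min_clique_sum (s + 1) t n) > real n powr (real s - \<epsilon>)"
proof -
  \<comment> \<open>With \<open>K = n powr (\<epsilon> / 2)\<close> this choice gives \<open>K ^ L > n ^ s\<close>.\<close>
  obtain L :: nat where L: "real L > 2 * real s / \<epsilon>"
    using reals_Archimedean2 by blast
  obtain R :: nat where R: "\<forall>(V :: nat set) E f.
     factorization (Suc s) t V E \<and> f \<in> {..<R} \<rightarrow> V \<and> inj_on f {..<R} \<longrightarrow>
     (\<exists>i\<in>{1..t}. \<exists>H. H \<subseteq> {..<R} \<and> card H = s * L \<and> hyperclique (Suc s) V (E i) (f ` H))"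
    using ramsey_for_factorizations[where 'a = nat and m = "s * L" and r = "Suc s" and t = t] by (rule exE)
  define c where "c = real t * 4 ^ R * real s ^ s"
  have "(\<lambda>n. real n powr (- (\<epsilon> / 2))) \<longlonglongrightarrow> 0"
    using assms(3) by (intro tendsto_neg_powr filterlim_real_sequentially) auto
  then have "(\<lambda>n. c * real n powr (- (\<epsilon> / 2)) + real R ^ 2 / real n) \<longlonglongrightarrow> c * 0 + 0"
    by (intro tendsto_add tendsto_mult tendsto_const lim_const_over_n)
  then have "\<forall>\<^sub>F n in sequentially. c * real n powr (- (\<epsilon> / 2)) + real R ^ 2 / real n < 1"
    by (rule order_tendstoD) auto
  then show ?thesis
    using eventually_ge_at_top[of 2]
  proof eventually_elim
    case (elim n)
    define M where "M = real n powr (real s - \<epsilon>)"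
    define K where "K = real n powr (\<epsilon> / 2)"
    have n: "real n > 1" using elim(2) by simp
    show ?case
    proof (rule ccontr)
      assume "\<not> ?case"
      then have le: "real (min_clique_sum (Suc s) t n) \<le> M" by (simp add: M_def)
      obtain E where fac: "factorization (Suc s) t {..<n} E"
        and E: "min_clique_sum (Suc s) t n = (\<Sum>i=1..t. num_maximal_cliques (Suc s) {..<n} (E i))"
        using min_clique_sum_attained[of n t "Suc s"] elim(2) assms(2) by auto
      have colour_le: "real (num_maximal_cliques (Suc s) {..<n} (E i)) \<le> M" if "i \<in> {1..t}" for i
      proof -
        have "num_maximal_cliques (Suc s) {..<n} (E i) \<le> min_clique_sum (Suc s) t n"
          unfolding E by (rule member_le_sum) (use that in auto)
        then show ?thesis using le by linarith
      qed
      have "K * M / real n ^ s = real n powr (- (\<epsilon> / 2))"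
        using n by (simp add: K_def M_def field_simps flip: powr_add powr_realpow)
      then have "c * (K * M / real n ^ s) + real R ^ 2 / real n < 1"
        using elim(1) by simp
      then have "real t * 4 ^ R * (real s ^ s * (K * M) / real (card {..<n})^s)
                   + real R ^ 2 / real (card {..<n}) < 1"
        by (simp add: c_def mult.assoc)
      then have "K ^ L \<le> M"
        using power_le_total_cliques[OF fac assms(2) _ _ R[rule_format, OF conjI[OF fac conjI]]
            colour_le, of K] elim(2)
        by (auto simp: K_def lessThan_empty_iff)
      moreover have "K ^ L = real n powr (\<epsilon> / 2 * real L)"
        using n by (simp add: K_def powr_powr flip: powr_realpow)
      moreover have "real n powr (\<epsilon> / 2 * real L) > M"
        unfolding M_def using n L assms(3) by (intro powr_less_mono) (auto simp: field_simps)
      ultimately show False by simp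
    qed
  qed
qed

end
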